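(* Let $k\geq 3$ and let $T$ be a full $k$-ary tree of height $h$, and let $t = (h-1) \bmod 2$. Then $\mathrm{cdn}(T) = \dfrac{k^{h+1}-k^t}{k^2-1}$.
   Context: A claw is $K_{1,3}$. $\mathrm{cdn}(G)$ is the minimum number of vertices whose deletion from $G$ leaves a graph with no induced $K_{1,3}$. A full $k$-ary tree is a rooted tree in which every node has either zero or exactly $k$ children and all leaves have the same depth; its height is the depth of its leaves (the depth of a vertex being its distance to the root). *)

theory Defs
  imports Complex_Main "Graph_Theory.Graph_Theory"
begin

text \<open>
  Finite simple graphs are the symmetric loop-free digraphs without parallel arcs of the locale
  \<^locale>\<open>graph\<close>.  In such a digraph the walk \<open>u, v, u\<close> along an edge and back is a
  \<^const>\<open>pre_digraph.cycle\<close>, so \<^const>\<open>forest\<close> cannot be used for undirected acyclicity.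
  The cycles of the underlying undirected graph are exactly those of length at least 3.
\<close>

definition undirected_tree :: "('a, 'b) pre_digraph \<Rightarrow> bool" where
  "undirected_tree G \<longleftrightarrow> graph G \<and> Digraph_Component.connected G \<and>
     \<not> (\<exists>p. pre_digraph.cycle G p \<and> 3 \<le> length p)"

definition graph_dist :: "('a, 'b) pre_digraph \<Rightarrow> 'a \<Rightarrow> 'a \<Rightarrow> nat" where
  "graph_dist G u v = (LEAST n. \<exists>p. pre_digraph.awalk G u p v \<and> length p = n)"

definition depth :: "('a, 'b) pre_digraph \<Rightarrow> 'a \<Rightarrow> 'a \<Rightarrow> nat" where
  "depth G r v = graph_dist G v r"

definition children :: "('a, 'b) pre_digraph \<Rightarrow> 'a \<Rightarrow> 'a \<Rightarrow> 'a set" where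
  "children G r v = {w. v \<rightarrow>\<^bsub>G\<^esub> w \<and> depth G r w = depth G r v + 1}"

text \<open>
  A leaf is a node without children, so the root of the one-vertex tree (height 0) is a leaf.
  A finite rooted tree has a leaf, hence \<open>h\<close> is determined by \<open>T\<close> and \<open>r\<close>.
\<close>

definition full_kary_tree :: "nat \<Rightarrow> nat \<Rightarrow> ('a, 'b) pre_digraph \<Rightarrow> 'a \<Rightarrow> bool" where
  "full_kary_tree k h T r \<longleftrightarrow> undirected_tree T \<and> r \<in> verts T \<and>
     (\<forall>v \<in> verts T. card (children T r v) = 0 \<or> card (children T r v) = k) \<and>
     (\<forall>v \<in> verts T. children T r v = {} \<longrightarrow> depth T r v = h)"

definition claw_free :: "('a, 'b) pre_digraph \<Rightarrow> bool" where
  "claw_free G \<longleftrightarrow> \<not> (\<exists>H. induced_subgraph H G \<and> K\<^bsub>1,3\<^esub> H)"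

definition cdn :: "('a, 'b) pre_digraph \<Rightarrow> nat" where
  "cdn G = (LEAST n. \<exists>S \<subseteq> verts G. card S = n \<and>
     claw_free (G \<restriction> (verts G - S)))"

end

theory Submission
  imports Defs
begin

text \<open>
  Let \<open>A\<close> be the set of vertices on the levels \<open>h - 1, h - 3, h - 5, \<dots>\<close>.  Adjacent vertices lie on
  consecutive levels, so deleting \<open>A\<close> leaves no edge at all, let alone a claw.  Conversely, the
  stars formed by the vertices of \<open>A\<close> together with their children are pairwise disjoint, and
  each contains an induced claw since \<open>k \<ge> 3\<close>, so at least \<open>card A\<close> vertices must be deleted.
  As level \<open>i\<close> has \<open>k ^ i\<close> vertices, \<open>card A\<close> is a geometric sum of ratio \<open>k\<^sup>2\<close>.

  Acyclicity enters only through the fact that two distinct vertices of equal depth are joined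
  by a path of length at least 2 that never goes deeper: an edge between them, or a common
  child, would close it to a cycle.
\<close>

section \<open>Edgeless graphs and claws\<close>

lemma arcs_ends_induce_subgraph: "arcs_ends (G \<restriction> W) = arcs_ends G \<inter> W \<times> W"
  by (auto simp: arcs_ends_conv)

lemma claw_freeI_edgeless:
  assumes "arcs_ends H = {}"
  shows "claw_free H"
  unfolding claw_free_def
proof clarify
  fix K assume "induced_subgraph K H" "K\<^bsub>1,3\<^esub> K"
  \<comment> \<open>The parts of a claw in \<open>H\<close> would span no arcs, yet the product of
    two nonempty sets is nonempty.\<close>
  then obtain U V :: "'a set" where "card U = 1" "card V = 3" "U \<times> V \<union> V \<times> U = {}"
    using assms arcs_ends_mono[OF induced_imp_subgraph, of K H]
    by (auto simp: complete_bipartite_digraph_def)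
  then show False by auto
qed

section \<open>Depth and parents in a rooted tree\<close>

locale rooted_tree = graph G for G :: "('a, 'b) pre_digraph" (structure) +
  fixes r :: 'a
  assumes connected_G: "Digraph_Component.connected G"
    and no_long_cycle: "cycle p \<Longrightarrow> length p < 3"
    and root_in_verts: "r \<in> verts G"
begin

abbreviation dep :: "'a \<Rightarrow> nat" where
  "dep \<equiv> depth G r"

lemma shortest_walk_to_root:
  assumes "v \<in> verts G"
  obtains p where "awalk v p r" "length p = dep v"
proof -
  have "v \<rightarrow>\<^sup>*\<^bsub>mk_symmetric G\<^esub> r"
    using connected_G assms root_in_verts
    by (auto simp: Digraph_Component.connected_def strongly_connected_def)
  then have "v \<rightarrow>\<^sup>*\<^bsub>G\<^esub> r" using reachable_mk_symmetric_eq[OF sym_arcs] by simp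
  then have "\<exists>n p. awalk v p r \<and> length p = n" by (auto simp: reachable_awalk)
  then have "\<exists>p. awalk v p r \<and> length p = dep v"
    unfolding depth_def graph_dist_def by (rule LeastI_ex)
  then show ?thesis using that by blast
qed

lemma depth_le_length: "awalk v p r \<Longrightarrow> dep v \<le> length p"
  unfolding depth_def graph_dist_def by (rule Least_le) blast

lemma depth_eq_0_iff: "v \<in> verts G \<Longrightarrow> dep v = 0 \<longleftrightarrow> v = r"
proof
  assume v: "v \<in> verts G" "dep v = 0"
  then obtain p where "awalk v p r" "length p = dep v" using shortest_walk_to_root by blast
  then show "v = r" using v by (auto simp: awalk_Nil_iff)
next
  assume "v \<in> verts G" "v = r"
  then show "dep v = 0" using depth_le_length[of r "[]"] by (simp add: awalk_Nil_iff)
qed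

lemma depth_adjacent_le: "u \<rightarrow>\<^bsub>G\<^esub> v \<Longrightarrow> dep u \<le> Suc (dep v)"
proof -
  assume uv: "u \<rightarrow>\<^bsub>G\<^esub> v"
  then obtain e where e: "e \<in> arcs G" "tail G e = u" "head G e = v" by (rule reachableE)
  obtain p where p: "awalk v p r" "length p = dep v"
    using shortest_walk_to_root adj_in_verts[OF uv] by blast
  have "awalk u (e # p) r" using e p by (simp add: awalk_Cons_iff)
  from depth_le_length[OF this] p show ?thesis by simp
qed

text \<open>The second vertex of a shortest walk to the root serves: the rest of the walk bounds its
  depth by \<open>n\<close>, and an arc lowers the depth by at most one.\<close>

lemma parent_exists:
  assumes "v \<in> verts G" "dep v = Suc n"
  obtains u where "v \<rightarrow>\<^bsub>G\<^esub> u" "dep u = n"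
proof -
  obtain p where p: "awalk v p r" "length p = dep v"
    using shortest_walk_to_root assms by blast
  then obtain e q where pq: "p = e # q" using assms by (cases p) auto
  then have e: "e \<in> arcs G" "tail G e = v" and q: "awalk (head G e) q r"
    using p by (auto simp: awalk_Cons_iff)
  then have ve: "v \<rightarrow>\<^bsub>G\<^esub> head G e" using in_arcs_imp_in_arcs_ends by blast
  moreover have "dep (head G e) \<le> n"
    using depth_le_length[OF q] p pq assms by simp
  ultimately have "dep (head G e) = n" using depth_adjacent_le[OF ve] assms by simp
  then show ?thesis using that ve by blast
qed

text \<open>Ascend from both ends to parents, join these by the induction hypothesis, descend again.
  The new ends lie strictly deeper than everything in between, so no vertex repeats.\<close>

lemma path_between_equal_depth:
  assumes "x \<in> verts G" "y \<in> verts G" "x \<noteq> y" "dep x = n" "dep y = n"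
  shows "\<exists>p. apath x p y \<and> 2 \<le> length p \<and> (\<forall>z \<in> set (awalk_verts x p). dep z \<le> n)"
  using assms
proof (induction n arbitrary: x y)
  case 0
  then show ?case by (simp add: depth_eq_0_iff)
next
  case (Suc n)
  obtain x' where x': "x \<rightarrow>\<^bsub>G\<^esub> x'" "dep x' = n" using parent_exists Suc.prems by blast
  obtain y' where y': "y \<rightarrow>\<^bsub>G\<^esub> y'" "dep y' = n" using parent_exists Suc.prems by blast
  obtain e where e: "e \<in> arcs G" "tail G e = x" "head G e = x'" using x'(1) by (rule reachableE)
  obtain f where f: "f \<in> arcs G" "tail G f = y'" "head G f = y"
    using graph_symmetric[OF y'(1)] by (rule reachableE)
  \<comment> \<open>A common parent is joined to itself by the empty path; the two outer arcs alone
    then give length 2.\<close>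
  obtain p where p: "apath x' p y'" "\<forall>z \<in> set (awalk_verts x' p). dep z \<le> n"
  proof (cases "x' = y'")
    case True
    then show ?thesis
      using that[of "[]"] x' adj_in_verts[OF x'(1)] by (simp add: apath_Nil_iff)
  next
    case False
    then show ?thesis
      using Suc.IH[of x' y'] that x' y' adj_in_verts by fastforce
  qed
  have x'y: "awalk x' (p @ [f]) y" using p(1) f by (auto simp: apath_def awalk_simps)
  have vs: "awalk_verts x (e # p @ [f]) = x # awalk_verts x' p @ [y]"
    using awalk_verts_append[OF x'y] e f by simp
  have "awalk x (e # p @ [f]) y"
    using x'y e by (simp add: awalk_Cons_iff del: awalk_append_iff)
  moreover have "distinct (awalk_verts x (e # p @ [f]))"
    using p Suc.prems unfolding vs by (force simp: apath_def)
  moreover have "\<forall>z \<in> set (awalk_verts x (e # p @ [f])). dep z \<le> Suc n"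
    using p(2) Suc.prems unfolding vs by auto
  ultimately show ?case unfolding apath_def by (intro exI[of _ "e # p @ [f]"]) auto
qed

lemma adjacent_depth_neq:
  assumes "u \<rightarrow>\<^bsub>G\<^esub> v"
  shows "dep u \<noteq> dep v"
proof
  assume eq: "dep u = dep v"
  have "u \<noteq> v" using assms adj_not_same by blast
  then obtain p where p: "apath u p v" "2 \<le> length p"
    using path_between_equal_depth eq adj_in_verts[OF assms] by metis
  obtain e where e: "e \<in> arcs G" "tail G e = v" "head G e = u"
    using graph_symmetric[OF assms] by (rule reachableE)
  \<comment> \<open>The arc \<open>e\<close> back from \<open>v\<close> to \<open>u\<close> makes a
    cycle of length at least 3.\<close>
  have "cycle (e # p)"
    using p e unfolding cycle_def by (intro exI[of _ v]) (auto simp: apath_def awalk_Cons_iff)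
  then show False using no_long_cycle p by fastforce
qed

lemma adjacent_depth: "u \<rightarrow>\<^bsub>G\<^esub> v \<Longrightarrow> dep v = Suc (dep u) \<or> dep u = Suc (dep v)"
  using adjacent_depth_neq depth_adjacent_le graph_symmetric
  by (metis le_SucE le_antisym)

lemma parent_unique:
  assumes "u \<rightarrow>\<^bsub>G\<^esub> v" "w \<rightarrow>\<^bsub>G\<^esub> v" "dep v = Suc (dep u)" "dep v = Suc (dep w)"
  shows "u = w"
proof (rule ccontr)
  assume "u \<noteq> w"
  then obtain p where p: "apath u p w" "2 \<le> length p" "\<forall>z \<in> set (awalk_verts u p). dep z \<le> dep u"
    using path_between_equal_depth[of u w "dep u"] assms adj_in_verts by fastforce
  obtain e where e: "e \<in> arcs G" "tail G e = v" "head G e = u"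
    using graph_symmetric[OF assms(1)] by (rule reachableE)
  obtain f where f: "f \<in> arcs G" "tail G f = w" "head G f = v"
    using assms(2) by (rule reachableE)
  have uv: "awalk u (p @ [f]) v" using p f by (auto simp: apath_def awalk_simps)
  have "awalk_verts u (p @ [f]) = awalk_verts u p @ [v]"
    using awalk_verts_append[OF uv] f by simp
  \<comment> \<open>The path never goes deeper than \<open>u\<close>, while \<open>v\<close> is one
    level deeper; hence the detour through \<open>v\<close> closes it to a cycle.\<close>
  moreover have "v \<notin> set (awalk_verts u p)" using p(3) assms by force
  ultimately have "cycle (e # p @ [f])"
    using p uv e unfolding cycle_def
    by (intro exI[of _ v]) (auto simp: apath_def awalk_Cons_iff)
  then show False using no_long_cycle p by fastforce
qed

section \<open>Children, levels and stars\<close>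

lemma children_subset_verts: "children G r v \<subseteq> verts G"
  by (auto simp: children_def adj_in_verts)

lemma finite_children: "finite (children G r v)"
  using children_subset_verts finite_verts finite_subset by blast

lemma children_disjoint: "u \<noteq> v \<Longrightarrow> children G r u \<inter> children G r v = {}"
  using parent_unique by (auto simp: children_def)

lemma level_Suc:
  "{v \<in> verts G. dep v = Suc i} = (\<Union>u \<in> {v \<in> verts G. dep v = i}. children G r u)"
proof (intro set_eqI iffI)
  fix v assume "v \<in> {v \<in> verts G. dep v = Suc i}"
  then obtain u where "v \<rightarrow>\<^bsub>G\<^esub> u" "dep u = i" "dep v = Suc i" using parent_exists by auto
  then show "v \<in> (\<Union>u \<in> {v \<in> verts G. dep v = i}. children G r u)"
    using graph_symmetric[of v u] adj_in_verts(2)[of v u] by (auto simp: children_def)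
qed (auto simp: children_def adj_in_verts)

text \<open>Siblings have equal depth and so are not adjacent: \<open>v\<close> and any three of its
  children induce a claw. The set \<open>W\<close> stands for the vertices that survive a
  deletion.\<close>

lemma claw_in_star:
  assumes "3 \<le> card (children G r v)" "insert v (children G r v) \<subseteq> W" "W \<subseteq> verts G"
  shows "\<not> claw_free (G \<restriction> W)"
proof -
  obtain C where C: "C \<subseteq> children G r v" "card C = 3"
    using assms(1) obtain_subset_with_card_n by metis
  let ?X = "insert v C"
  have X: "?X \<subseteq> W" using assms(2) C by auto
  have adj: "a \<rightarrow>\<^bsub>G\<^esub> b \<longleftrightarrow> a = v \<and> b \<in> C \<or> a \<in> C \<and> b = v" if "a \<in> ?X" "b \<in> ?X" for a b
  proof -
    have "v \<rightarrow>\<^bsub>G\<^esub> c \<and> c \<rightarrow>\<^bsub>G\<^esub> v \<and> dep c = Suc (dep v)" if "c \<in> C" for c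
      using that C graph_symmetric by (auto simp: children_def)
    then show ?thesis using that adjacent_depth_neq[of a b] by auto
  qed
  have "v \<notin> C" using C by (auto simp: children_def)
  moreover have "induced_subgraph (G \<restriction> ?X) G" using X assms(3) by (intro induced_induce) blast
  then have "graph (G \<restriction> ?X)"
    using digraph_subgraph induced_graph_imp_symmetric[OF sym_arcs] induced_imp_subgraph
    by (blast intro: digraph.graphI)
  moreover have "arcs_ends (G \<restriction> ?X) = {v} \<times> C \<union> C \<times> {v}"
    using adj by (auto simp: arcs_ends_induce_subgraph)
  ultimately have "K\<^bsub>1,3\<^esub> (G \<restriction> ?X)"
    unfolding complete_bipartite_digraph_def using C
    by (intro conjI exI[of _ "{v}"] exI[of _ C]) simp_all
  moreover have "induced_subgraph (G \<restriction> ?X) (G \<restriction> W)"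
    using X by (intro induced_subgraphI subgraphI) (auto simp: compatible_def)
  ultimately show ?thesis unfolding claw_free_def by blast
qed

end

section \<open>Full \<open>k\<close>-ary trees and their claw deletion number\<close>

locale full_kary = rooted_tree +
  fixes k h :: nat
  assumes card_children: "v \<in> verts G \<Longrightarrow> card (children G r v) = 0 \<or> card (children G r v) = k"
    and leaf_depth: "v \<in> verts G \<Longrightarrow> children G r v = {} \<Longrightarrow> dep v = h"
    and k_ge_3: "3 \<le> k"
begin

text \<open>A vertex of maximal depth has no children, hence is a leaf, and leaves have depth
  \<open>h\<close>.\<close>

lemma depth_le_height: "v \<in> verts G \<Longrightarrow> dep v \<le> h"
proof -
  assume v: "v \<in> verts G"
  have "Max (dep ` verts G) \<in> dep ` verts G" using v by (intro Max_in) auto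
  then obtain m where m: "m \<in> verts G" "dep m = Max (dep ` verts G)" by auto
  have le: "dep w \<le> dep m" if "w \<in> verts G" for w using that m by simp
  have "children G r m = {}"
    using le children_subset_verts[of m] by (fastforce simp: children_def)
  then show ?thesis using leaf_depth m le v by metis
qed

lemma card_children_inner: "v \<in> verts G \<Longrightarrow> dep v < h \<Longrightarrow> card (children G r v) = k"
  using card_children leaf_depth finite_children by (metis card_0_eq less_irrefl)

text \<open>Unique parents make the next level a disjoint union of child sets, each of size
  \<open>k\<close> as long as the parents lie above level \<open>h\<close>.\<close>

lemma card_level: "i \<le> h \<Longrightarrow> card {v \<in> verts G. dep v = i} = k ^ i"
proof (induction i)
  case 0
  have "{v \<in> verts G. dep v = 0} = {r}" using depth_eq_0_iff root_in_verts by auto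
  then show ?case by simp
next
  case (Suc i)
  have "card {v \<in> verts G. dep v = Suc i} = (\<Sum>u \<in> {v \<in> verts G. dep v = i}. card (children G r u))"
    unfolding level_Suc
    by (intro card_UN_disjoint) (auto simp: finite_children dest: children_disjoint)
  also have "\<dots> = (\<Sum>u \<in> {v \<in> verts G. dep v = i}. k)"
    using Suc.prems by (intro sum.cong) (auto simp: card_children_inner)
  finally show ?case using Suc by simp
qed

text \<open>Levels are counted upwards from the leaves, which stay outside. A truncated difference
  would be 0 and hence even, so membership forces \<open>dep v < h\<close>.\<close>

definition alternate :: "'a set" where
  "alternate = {v \<in> verts G. odd (h - dep v)}"

lemma claw_free_del_alternate: "claw_free (G \<restriction> (verts G - alternate))"
proof (rule claw_freeI_edgeless)
  \<comment> \<open>The ends of an edge have consecutive depths, both at most \<open>h\<close>, so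
    exactly one of them is in \<open>alternate\<close>.\<close>
  have False if "a \<rightarrow>\<^bsub>G\<^esub> b" "a \<notin> alternate" "b \<notin> alternate" for a b
    using that adjacent_depth[OF that(1)] adj_in_verts[OF that(1)]
      depth_le_height[of a] depth_le_height[of b]
    unfolding alternate_def by (auto simp: even_diff_nat)
  then show "arcs_ends (G \<restriction> (verts G - alternate)) = {}"
    by (auto simp: arcs_ends_induce_subgraph)
qed

text \<open>\<open>S\<close> must meet the star of every vertex of \<open>alternate\<close>. Picking
  one common element per star is injective because the stars are disjoint.\<close>

lemma card_alternate_le:
  assumes "S \<subseteq> verts G" "claw_free (G \<restriction> (verts G - S))"
  shows "card alternate \<le> card S"
proof -
  let ?star = "\<lambda>v. insert v (children G r v)"
  have "\<exists>x. x \<in> S \<inter> ?star v" if "v \<in> alternate" for v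
  proof (rule ccontr)
    assume "\<nexists>x. x \<in> S \<inter> ?star v"
    then have "?star v \<subseteq> verts G - S"
      using that children_subset_verts[of v] by (auto simp: alternate_def)
    moreover have "dep v < h" using that by (cases "dep v < h") (auto simp: alternate_def)
    then have "card (children G r v) = k"
      using that card_children_inner by (auto simp: alternate_def)
    ultimately show False using claw_in_star assms k_ge_3 by blast
  qed
  then obtain f where f: "\<And>v. v \<in> alternate \<Longrightarrow> f v \<in> S \<inter> ?star v" by metis
  \<comment> \<open>Child sets are disjoint by uniqueness of parents; a centre is no child of
    another centre, since their depths have equal parity.\<close>
  have disj: "?star u \<inter> ?star v = {}" if "u \<in> alternate" "v \<in> alternate" "u \<noteq> v" for u v
    using that children_disjoint[of u v] by (auto simp: alternate_def children_def)
  have "inj_on f alternate"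
    using f disj by (intro inj_onI) (metis IntD2 IntI empty_iff)
  moreover have "f ` alternate \<subseteq> S" using f by auto
  moreover have "finite S" using assms(1) finite_verts finite_subset by blast
  ultimately show ?thesis by (rule card_inj_on_le)
qed

lemma cdn_eq_card_alternate: "cdn G = card alternate"
  unfolding cdn_def
proof (rule Least_equality)
  show "\<exists>S\<subseteq>verts G. card S = card alternate \<and> claw_free (G \<restriction> (verts G - S))"
    using claw_free_del_alternate by (intro exI[of _ alternate]) (auto simp: alternate_def)
qed (use card_alternate_le in blast)

lemma card_alternate: "card alternate = (\<Sum>i | i < h \<and> odd (h - i). k ^ i)"
proof -
  have "alternate = (\<Union>i \<in> {i. i < h \<and> odd (h - i)}. {v \<in> verts G. dep v = i})"
    using odd_pos by (fastforce simp: alternate_def)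
  then have "card alternate = (\<Sum>i | i < h \<and> odd (h - i). card {v \<in> verts G. dep v = i})"
    by (simp only:) (intro card_UN_disjoint, auto)
  also have "\<dots> = (\<Sum>i | i < h \<and> odd (h - i). k ^ i)"
    by (intro sum.cong) (auto simp: card_level)
  finally show ?thesis .
qed

end

section \<open>The geometric sum in closed form\<close>

lemma alternating_power_sum:
  fixes x :: "'a :: comm_ring_1"
  shows "(\<Sum>i | i < h \<and> odd (h - i). x ^ i) * (x\<^sup>2 - 1) = x ^ (h + 1) - x ^ (if even h then 1 else 0)"
proof (induction h rule: induct_nat_012)
  case 0
  then show ?case by simp
next
  case 1
  have "{i. i < Suc 0 \<and> odd (Suc 0 - i)} = {0}" by auto
  then show ?case by (simp add: power2_eq_square)
next
  case (ge2 n)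
  \<comment> \<open>Raising the height by two keeps all parities and adds only the exponent
    \<open>n + 1\<close>; its term times \<open>x\<^sup>2 - 1\<close> telescopes with the induction
    hypothesis.\<close>
  have "{i. i < Suc (Suc n) \<and> odd (Suc (Suc n) - i)} = insert (Suc n) {i. i < n \<and> odd (n - i)}"
    by (auto simp: less_Suc_eq Suc_diff_le)
  then have "(\<Sum>i | i < Suc (Suc n) \<and> odd (Suc (Suc n) - i). x ^ i)
      = x ^ Suc n + (\<Sum>i | i < n \<and> odd (n - i). x ^ i)" by simp
  then show ?case using ge2 by (simp add: algebra_simps power2_eq_square)
qed

theorem theorem9:
  fixes T :: "('a, 'b) pre_digraph" and r :: 'a and k h t :: nat
  assumes "3 \<le> k"
    and "full_kary_tree k h T r"
    and "int t = (int h - 1) mod 2"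
  shows "real (cdn T) = (real k ^ (h + 1) - real k ^ t) / (real k ^ 2 - 1)"
proof -
  have tree: "undirected_tree T" using assms by (simp add: full_kary_tree_def)
  then interpret graph T by (simp add: undirected_tree_def)
  interpret rooted_tree T r
  proof
    show "length p < 3" if "cycle p" for p
      using that tree not_le unfolding undirected_tree_def by blast
  qed (use assms tree in \<open>simp_all add: full_kary_tree_def undirected_tree_def\<close>)
  interpret full_kary T r k h
    using assms by unfold_locales (simp_all add: full_kary_tree_def)
  \<comment> \<open>The integer \<open>mod\<close> gives \<open>t = 1\<close> also for
    \<open>h = 0\<close>, where the numerator becomes \<open>k - k = 0\<close>, as it should for a
    single vertex.\<close>
  have t: "t = (if even h then 1 else 0)" using assms(3) by presburger
  have "real (cdn T) = (\<Sum>i | i < h \<and> odd (h - i). real k ^ i)"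
    by (simp add: cdn_eq_card_alternate card_alternate)
  then have "real (cdn T) * (real k ^ 2 - 1) = real k ^ (h + 1) - real k ^ t"
    using alternating_power_sum[where x = "real k"] t by simp
  moreover have "real k ^ 2 - 1 \<noteq> 0"
    using assms(1) by (simp add: power2_eq_1_iff)
  ultimately show ?thesis by (simp add: field_simps)
qed

end
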